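(* The following properties hold for all $\mathbf\Psi$-triangle families, with the concatenation $\circ$ defined in the context: (i) The concatenation of triangle families commutes: $\mathbf\Psi\circ\tilde{\mathbf\Psi}=\tilde{\mathbf\Psi}\circ\mathbf\Psi$. (ii) The concatenation of triangle families is associative: $\mathbf\Psi\circ(\tilde{\mathbf\Psi}\circ\hat{\mathbf\Psi})=(\mathbf\Psi\circ\tilde{\mathbf\Psi})\circ\hat{\mathbf\Psi}$. (iii) $\mathbf\Phi_{\mathrm{Id}}:t\mapsto(1,0,0)$ is a neutral element with respect to the concatenation: $\mathbf\Psi\circ\mathbf\Phi_{\mathrm{Id}}=\mathbf\Psi$. (iv) Every $\mathbf\Psi$-triangle family has an inverse, $$\mathbf\Psi^{-1}:t\mapsto\begin{pmatrix}(\Psi_1)^2-\Psi_2\Psi_3\\ (\Psi_3)^2-\Psi_1\Psi_2\\ (\Psi_2)^2-\Psi_3\Psi_1\end{pmatrix}.$$ Consequently, the set of all $\mathbf\Psi$-triangle families in combination with the concatenation is an Abelian group with neutral element $\mathbf\Phi_{\mathrm{Id}}$.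
   Context: Let $\triangle$ be the set of non-degenerate triangles in $\mathbb R^2$. A $\mathbf\Psi$-triangle family $t\mapsto\Delta_t^{\mathbf\Psi}\in\triangle$ is determined by a triangle $\Delta=(\mathbf A,\mathbf B,\mathbf C)\in\triangle$ and three scalar-valued functions $\mathbf\Psi=(\Psi_1,\Psi_2,\Psi_3):\mathbb R\to\mathbb R^3$ such that $\Psi_1(t)+\Psi_2(t)+\Psi_3(t)\neq0$ and not $\Psi_1(t)\equiv\Psi_2(t)\equiv\Psi_3(t)$. The vertices of $\Delta_t^{\mathbf\Psi}$ have homogeneous barycentric coordinates $\mathbf A_t=[\Psi_1(t):\Psi_2(t):\Psi_3(t)]$, $\mathbf B_t=[\Psi_3(t):\Psi_1(t):\Psi_2(t)]$, $\mathbf C_t=[\Psi_2(t):\Psi_3(t):\Psi_1(t)]$ with respect to $\mathbf A,\mathbf B,\mathbf C$. Since these coordinates are homogeneous, triples differing by a nonvanishing scalar factor describe the same triangle family. The concatenation of two triangle families is $$\mathbf\Psi\circ\tilde{\mathbf\Psi}:t\mapsto\begin{pmatrix}\Psi_1\tilde\Psi_1+\Psi_2\tilde\Psi_3+\Psi_3\tilde\Psi_2\\ \Psi_1\tilde\Psi_2+\Psi_2\tilde\Psi_1+\Psi_3\tilde\Psi_3\\ \Psi_1\tilde\Psi_3+\Psi_2\tilde\Psi_2+\Psi_3\tilde\Psi_1\end{pmatrix}.$$ *)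

theory Defs
  imports "HOL-Analysis.Analysis" "HOL-Algebra.Group"
begin

type_synonym triangle = "(real^2) \<times> (real^2) \<times> (real^2)"

definition triangles :: "triangle set" where
  "triangles = {(A, B, C). \<not> collinear {A, B, C}}"

definition barycentric :: "triangle \<Rightarrow> real \<Rightarrow> real \<Rightarrow> real \<Rightarrow> real^2" where
  "barycentric T u v w =
    (case T of (A, B, C) \<Rightarrow> (1 / (u + v + w)) *\<^sub>R (u *\<^sub>R A + v *\<^sub>R B + w *\<^sub>R C))"

text \<open>Both conditions are imposed at every parameter value. At a parameter where the three
  coordinates agree, all three vertices would coincide with the centroid.\<close>

definition family_coords :: "(real \<Rightarrow> real^3) set" where
  "family_coords = {\<Psi>. \<forall>t. \<Psi> t $ 1 + \<Psi> t $ 2 + \<Psi> t $ 3 \<noteq> 0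
                          \<and> \<not> (\<Psi> t $ 1 = \<Psi> t $ 2 \<and> \<Psi> t $ 2 = \<Psi> t $ 3)}"

definition triangle_family :: "triangle \<Rightarrow> (real \<Rightarrow> real^3) \<Rightarrow> real \<Rightarrow> triangle" where
  "triangle_family \<Delta> \<Psi> = (\<lambda>t.
     (barycentric \<Delta> (\<Psi> t $ 1) (\<Psi> t $ 2) (\<Psi> t $ 3),
      barycentric \<Delta> (\<Psi> t $ 3) (\<Psi> t $ 1) (\<Psi> t $ 2),
      barycentric \<Delta> (\<Psi> t $ 2) (\<Psi> t $ 3) (\<Psi> t $ 1)))"

lemma barycentric_relation_trivial:
  fixes A B C :: "real^2"
  assumes nc: "\<not> collinear {A,B,C}"
    and s: "x + y + z = (0::real)" and e: "x *\<^sub>R A + y *\<^sub>R B + z *\<^sub>R C = 0"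
  shows "x = 0 \<and> y = 0 \<and> z = 0"
proof -
  have d: "A \<noteq> B" "A \<noteq> C" "B \<noteq> C" using nc by (auto simp: insert_commute)
  have nd: "\<not> affine_dependent {A,B,C}"
    using nc d by (metis collinear_3_eq_affine_dependent)
  define U where "U = (\<lambda>p. if p = A then x else if p = B then y else z)"
  have "sum U {A,B,C} = 0" using d s by (simp add: U_def)
  moreover have "(\<Sum>v\<in>{A,B,C}. U v *\<^sub>R v) = 0" using d e by (simp add: U_def add.assoc)
  ultimately have "\<forall>v\<in>{A,B,C}. U v = 0"
    using nd affine_dependent_explicit_finite[of "{A,B,C}"] by blast
  then show ?thesis using d by (auto simp: U_def)
qed

lemma barycentric_eqD:
  assumes "\<Delta> \<in> triangles" "u+v+w \<noteq> 0" "u'+v'+w' \<noteq> 0"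
    "barycentric \<Delta> u v w = barycentric \<Delta> u' v' w'"
  shows "u/(u+v+w) = u'/(u'+v'+w') \<and> v/(u+v+w) = v'/(u'+v'+w') \<and> w/(u+v+w) = w'/(u'+v'+w')"
proof -
  obtain A B C where D: "\<Delta> = (A,B,C)" "\<not> collinear {A,B,C}" using assms(1) by (auto simp: triangles_def)
  let ?s = "u+v+w" and ?s' = "u'+v'+w'"
  have "(u/?s - u'/?s') *\<^sub>R A + (v/?s - v'/?s') *\<^sub>R B + (w/?s - w'/?s') *\<^sub>R C = 0"
    using assms(4) D(1) by (simp add: barycentric_def algebra_simps)
  moreover have "(u/?s - u'/?s') + (v/?s - v'/?s') + (w/?s - w'/?s') = 0"
  proof -
    have "u/?s + v/?s + w/?s = 1" "u'/?s' + v'/?s' + w'/?s' = 1"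
      using assms(2,3) by (simp_all add: add_divide_distrib[symmetric])
    then show ?thesis by simp
  qed
  ultimately show ?thesis using barycentric_relation_trivial[OF D(2)] by (metis eq_iff_diff_eq_0)
qed

lemma triangle_family_eq_iff:
  assumes "\<Delta> \<in> triangles" "\<Psi> \<in> family_coords" "\<Psi>' \<in> family_coords"
  shows "triangle_family \<Delta> \<Psi> = triangle_family \<Delta> \<Psi>' \<longleftrightarrow>
    (\<exists>k. \<forall>t. k t \<noteq> 0 \<and> \<Psi>' t = k t *\<^sub>R \<Psi> t)" (is "?L \<longleftrightarrow> ?R")
proof
  assume L: ?L
  define s where "s = (\<lambda>t. \<Psi> t $ 1 + \<Psi> t $ 2 + \<Psi> t $ 3)"
  define s' where "s' = (\<lambda>t. \<Psi>' t $ 1 + \<Psi>' t $ 2 + \<Psi>' t $ 3)"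
  have n: "s t \<noteq> 0" "s' t \<noteq> 0" for t
    using assms by (auto simp: s_def s'_def family_coords_def)
  have *: "\<Psi> t $ i / s t = \<Psi>' t $ i / s' t" for t i
  proof -
    have "barycentric \<Delta> (\<Psi> t $ 1) (\<Psi> t $ 2) (\<Psi> t $ 3) = barycentric \<Delta> (\<Psi>' t $ 1) (\<Psi>' t $ 2) (\<Psi>' t $ 3)"
      using fun_cong[OF L, of t] by (simp add: triangle_family_def)
    from barycentric_eqD[OF assms(1) _ _ this] n[of t]
    show ?thesis using exhaust_3[of i] by (auto simp: s_def s'_def)
  qed
  have "s' t / s t \<noteq> 0 \<and> \<Psi>' t = (s' t / s t) *\<^sub>R \<Psi> t" for t
  proof -
    have "\<Psi>' t $ i = (s' t / s t) * \<Psi> t $ i" for i using *[of t i] n[of t] by (simp add: field_simps)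
    then show ?thesis using n[of t] by (auto simp: vec_eq_iff)
  qed
  then show ?R by (intro exI[of _ "\<lambda>t. s' t / s t"]) blast
next
  assume ?R
  then obtain k where k: "\<And>t. k t \<noteq> 0" "\<And>t. \<Psi>' t = k t *\<^sub>R \<Psi> t" by blast
  have h: "barycentric \<Delta> (c * u) (c * v) (c * w) = barycentric \<Delta> u v w" if "c \<noteq> 0" for c u v w
  proof (cases \<Delta>)
    case fields: (fields A B C)
    have "1 / (c * u + c * v + c * w) * c = 1 / (u + v + w)"
      using that by (simp flip: distrib_left)
    moreover have "(c * u) *\<^sub>R A + (c * v) *\<^sub>R B + (c * w) *\<^sub>R C = c *\<^sub>R (u *\<^sub>R A + v *\<^sub>R B + w *\<^sub>R C)"
      by (simp add: scaleR_right_distrib)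
    ultimately show ?thesis using fields
      by (simp only: barycentric_def prod.case scaleR_scaleR)
  qed
  show ?L by (rule ext) (simp add: triangle_family_def k h)
qed

lemma collinear_coeffs:
  fixes A B C :: "real^2"
  assumes "collinear {A,B,C}"
  obtains x y z :: real where "x + y + z = 0" "x *\<^sub>R A + y *\<^sub>R B + z *\<^sub>R C = 0"
    "x \<noteq> 0 \<or> y \<noteq> 0 \<or> z \<noteq> 0"
proof (cases "A = C")
  case True
  then show ?thesis using that[of 1 0 "-1"] by simp
next
  case False
  then obtain u where "B = u *\<^sub>R A + (1 - u) *\<^sub>R C" using assms by (auto simp: collinear_3_expand)
  then show ?thesis using that[of u "-1" "1-u"] by simp
qed

lemma circulant_factor_eq_0_iff:
  "(a::real)\<^sup>2 + b\<^sup>2 + c\<^sup>2 - a*b - b*c - c*a = 0 \<longleftrightarrow> a = b \<and> b = c"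
proof
  assume "a\<^sup>2 + b\<^sup>2 + c\<^sup>2 - a*b - b*c - c*a = 0"
  then have "(a - b)\<^sup>2 + ((b - c)\<^sup>2 + (c - a)\<^sup>2) = 0"
    by (simp add: power2_eq_square algebra_simps)
  moreover have "(a - b)\<^sup>2 \<ge> 0" "(b - c)\<^sup>2 \<ge> 0" "(c - a)\<^sup>2 \<ge> 0" by simp_all
  ultimately have "(a - b)\<^sup>2 = 0" "(b - c)\<^sup>2 = 0" by linarith+
  then show "a = b \<and> b = c" by simp
qed (simp add: power2_eq_square)

lemma triangle_family_nondegenerate:
  assumes "\<Delta> \<in> triangles" "\<Psi> \<in> family_coords"
  shows "triangle_family \<Delta> \<Psi> t \<in> triangles"
proof (rule ccontr)
  obtain A B C where D: "\<Delta> = (A,B,C)" "\<not> collinear {A,B,C}" using assms(1) by (auto simp: triangles_def)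
  define p q r s where "p = \<Psi> t $ 1" and "q = \<Psi> t $ 2" and "r = \<Psi> t $ 3" and "s = 1/(p+q+r)"
  have s: "r+p+q = p+q+r" "q+r+p=p+q+r" by simp_all
  have n: "s \<noteq> 0" "p+q+r \<noteq> 0" "\<not> (p = q \<and> q = r)" using assms(2) by (auto simp: family_coords_def p_def q_def r_def s_def)
  assume "triangle_family \<Delta> \<Psi> t \<notin> triangles"
  then have "collinear {s *\<^sub>R (p *\<^sub>R A + q *\<^sub>R B + r *\<^sub>R C), s *\<^sub>R (r *\<^sub>R A + p *\<^sub>R B + q *\<^sub>R C), s *\<^sub>R (q *\<^sub>R A + r *\<^sub>R B + p *\<^sub>R C)}"
    by (simp add: triangles_def triangle_family_def D barycentric_def p_def[symmetric] q_def[symmetric] r_def[symmetric] s s_def[symmetric])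
  then obtain x y z where x: "x + y + z = 0"
    "x *\<^sub>R (s *\<^sub>R (p *\<^sub>R A + q *\<^sub>R B + r *\<^sub>R C)) + y *\<^sub>R (s *\<^sub>R (r *\<^sub>R A + p *\<^sub>R B + q *\<^sub>R C)) + z *\<^sub>R (s *\<^sub>R (q *\<^sub>R A + r *\<^sub>R B + p *\<^sub>R C)) = 0"
    "x \<noteq> 0 \<or> y \<noteq> 0 \<or> z \<noteq> 0" by (rule collinear_coeffs)
  have "s *\<^sub>R ((x*p+y*r+z*q) *\<^sub>R A + (x*q+y*p+z*r) *\<^sub>R B + (x*r+y*q+z*p) *\<^sub>R C) = 0"
    using x(2) by (simp add: algebra_simps)
  then have e: "(x*p+y*r+z*q) *\<^sub>R A + (x*q+y*p+z*r) *\<^sub>R B + (x*r+y*q+z*p) *\<^sub>R C = 0" using n(1) by simp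
  have "(x*p+y*r+z*q) + (x*q+y*p+z*r) + (x*r+y*q+z*p) = (x+y+z)*(p+q+r)" by algebra
  then have "(x*p+y*r+z*q) + (x*q+y*p+z*r) + (x*r+y*q+z*p) = 0" using x(1) by simp
  from barycentric_relation_trivial[OF D(2) this e]
  have g: "x*p+y*r+z*q = 0" "x*q+y*p+z*r = 0" "x*r+y*q+z*p = 0" by auto
  define d where "d = (p+q+r) * (p^2+q^2+r^2-p*q-q*r-r*p)"
  have "d \<noteq> 0" using n(2,3) circulant_factor_eq_0_iff[of p q r] unfolding d_def by (metis mult_eq_0_iff)
  moreover have "x*d = 0" "y*d = 0" "z*d=0" using g unfolding d_def by algebra+
  ultimately show False using x(3) by auto
qed

definition concatenation ::
    "(real \<Rightarrow> real^3) \<Rightarrow> (real \<Rightarrow> real^3) \<Rightarrow> real \<Rightarrow> real^3" (infixl "\<star>" 70) where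
  "\<Psi> \<star> \<Psi>' = (\<lambda>t. vector
     [\<Psi> t $ 1 * \<Psi>' t $ 1 + \<Psi> t $ 2 * \<Psi>' t $ 3 + \<Psi> t $ 3 * \<Psi>' t $ 2,
      \<Psi> t $ 1 * \<Psi>' t $ 2 + \<Psi> t $ 2 * \<Psi>' t $ 1 + \<Psi> t $ 3 * \<Psi>' t $ 3,
      \<Psi> t $ 1 * \<Psi>' t $ 3 + \<Psi> t $ 2 * \<Psi>' t $ 2 + \<Psi> t $ 3 * \<Psi>' t $ 1])"

definition \<Phi>_Id :: "real \<Rightarrow> real^3" where
  "\<Phi>_Id = (\<lambda>t. vector [1, 0, 0])"

definition inverse_coords :: "(real \<Rightarrow> real^3) \<Rightarrow> real \<Rightarrow> real^3" where
  "inverse_coords \<Psi> = (\<lambda>t. vector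
     [(\<Psi> t $ 1)\<^sup>2 - \<Psi> t $ 2 * \<Psi> t $ 3,
      (\<Psi> t $ 3)\<^sup>2 - \<Psi> t $ 1 * \<Psi> t $ 2,
      (\<Psi> t $ 2)\<^sup>2 - \<Psi> t $ 3 * \<Psi> t $ 1])"

text \<open>A family is the map \<open>t \<mapsto> \<Delta>\<^sub>t\<close> itself, so coordinate triples that differ by a
  nonvanishing scalar function are identified
  (see \<open>triangle_family_eq_iff\<close>). The product is the unique family obtained by
  concatenating representing triples.\<close>

definition family_group :: "triangle \<Rightarrow> (real \<Rightarrow> triangle) monoid" where
  "family_group \<Delta> =
    \<lparr>carrier = triangle_family \<Delta> ` family_coords,
     monoid.mult = (\<lambda>F G. THE H. \<exists>\<Psi>\<in>family_coords. \<exists>\<Psi>'\<in>family_coords.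
        F = triangle_family \<Delta> \<Psi> \<and> G = triangle_family \<Delta> \<Psi>' \<and> H = triangle_family \<Delta> (\<Psi> \<star> \<Psi>')),
     one = triangle_family \<Delta> \<Phi>_Id\<rparr>"

end

theory Submission
  imports Defs
begin

text \<open>Reading a coordinate triple \<open>(a, b, c)\<close> at a fixed parameter as the residue class of
  \<open>a + b x + c x\<^sup>2\<close> in the ring \<open>\<real>[x]/(x\<^sup>3 - 1)\<close>, the concatenation becomes the
  multiplication of this commutative ring, and \<open>\<Phi>_Id\<close> is its unit. This is why the laws (i) to
  (iii) hold for the triples themselves, before any rescaling.

  For the inverse, consider the determinant
  \<open>N(a,b,c) = a\<^sup>3 + b\<^sup>3 + c\<^sup>3 - 3abc\<close> of multiplication by \<open>(a, b, c)\<close>. It is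
  the norm of the ring and hence multiplicative. It also splits as \<open>a + b + c\<close> times a
  quadratic form that vanishes exactly on the diagonal. So the two conditions on the coordinates of
  a triangle family say together that the norm vanishes nowhere, that is, that the triple is a unit
  of the ring at each parameter. Units are closed under products. The triple \<open>\<Psi>\<^sup>-\<^sup>1\<close> is
  the first column of the adjugate matrix, so \<open>\<Psi> \<star> \<Psi>\<^sup>-\<^sup>1 = N(\<Psi>) \<Phi>_Id\<close>, and this
  describes the same family as \<open>\<Phi>_Id\<close>.

  Two triples describe the same family iff they differ by a nonvanishing scalar function. As the
  concatenation is bilinear, it is compatible with this relation, and the group of families is the
  quotient of the unit triples by the nonvanishing scalars.\<close>

definition circulant_norm :: "real^3 \<Rightarrow> real" where
  "circulant_norm v = (v $ 1)^3 + (v $ 2)^3 + (v $ 3)^3 - 3 * (v $ 1 * v $ 2 * v $ 3)"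

lemma concatenation_commute: "\<Psi> \<star> \<Psi>' = \<Psi>' \<star> \<Psi>"
  by (simp add: concatenation_def algebra_simps)

lemma concatenation_assoc: "\<Psi> \<star> (\<Psi>' \<star> \<Psi>'') = (\<Psi> \<star> \<Psi>') \<star> \<Psi>''"
  by (simp add: concatenation_def algebra_simps)

lemma concatenation_Id: "\<Psi> \<star> \<Phi>_Id = \<Psi>"
  by (simp add: concatenation_def \<Phi>_Id_def fun_eq_iff vec_eq_iff forall_3)

lemma concatenation_scaleR:
  "(\<lambda>t. k t *\<^sub>R \<Psi> t) \<star> (\<lambda>t. l t *\<^sub>R \<Psi>' t) = (\<lambda>t. (k t * l t) *\<^sub>R (\<Psi> \<star> \<Psi>') t)"
  by (simp add: concatenation_def fun_eq_iff vec_eq_iff forall_3 algebra_simps)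

text \<open>The sum of the coordinates is the eigenvalue of the circulant matrix at the cube root of
  unity 1; the quadratic factor is the product of the two complex conjugate eigenvalues.\<close>

lemma circulant_norm_factor:
  "circulant_norm v = (v $ 1 + v $ 2 + v $ 3) *
     ((v $ 1)\<^sup>2 + (v $ 2)\<^sup>2 + (v $ 3)\<^sup>2 - v $ 1 * v $ 2 - v $ 2 * v $ 3 - v $ 3 * v $ 1)"
  unfolding circulant_norm_def by algebra

lemma family_coords_iff_circulant_norm:
  "\<Psi> \<in> family_coords \<longleftrightarrow> (\<forall>t. circulant_norm (\<Psi> t) \<noteq> 0)"
  unfolding family_coords_def circulant_norm_factor mem_Collect_eq mult_eq_0_iff
    circulant_factor_eq_0_iff by blast

lemma circulant_norm_concatenation:
  "circulant_norm ((\<Psi> \<star> \<Psi>') t) = circulant_norm (\<Psi> t) * circulant_norm (\<Psi>' t)"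
  unfolding circulant_norm_def concatenation_def vector_3 by algebra

lemma circulant_norm_scaleR: "circulant_norm (k *\<^sub>R v) = k^3 * circulant_norm v"
  unfolding circulant_norm_def vector_scaleR_component real_scaleR_def by algebra

lemma concatenation_family_coords:
  assumes "\<Psi> \<in> family_coords" "\<Psi>' \<in> family_coords"
  shows "\<Psi> \<star> \<Psi>' \<in> family_coords"
  using assms by (simp add: family_coords_iff_circulant_norm circulant_norm_concatenation)

lemma circulant_norm_Id: "circulant_norm (\<Phi>_Id t) = 1"
  by (simp add: circulant_norm_def \<Phi>_Id_def)

lemma Id_family_coords: "\<Phi>_Id \<in> family_coords"
  by (simp add: family_coords_iff_circulant_norm circulant_norm_Id)

lemma concatenation_inverse_coords:
  "\<Psi> \<star> inverse_coords \<Psi> = (\<lambda>t. circulant_norm (\<Psi> t) *\<^sub>R \<Phi>_Id t)"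
  by (simp add: concatenation_def inverse_coords_def circulant_norm_def \<Phi>_Id_def fun_eq_iff
      vec_eq_iff forall_3 power2_eq_square power3_eq_cube algebra_simps)

text \<open>Taking norms in \<open>\<Psi> \<star> \<Psi>\<^sup>-\<^sup>1 = N(\<Psi>) \<Phi>_Id\<close> gives
  \<open>N(\<Psi>) N(\<Psi>\<^sup>-\<^sup>1) = N(\<Psi>)\<^sup>3\<close>, which is nonzero.\<close>

lemma inverse_coords_family_coords:
  assumes "\<Psi> \<in> family_coords"
  shows "inverse_coords \<Psi> \<in> family_coords"
proof -
  have "circulant_norm (\<Psi> t) * circulant_norm (inverse_coords \<Psi> t) = circulant_norm (\<Psi> t) ^ 3" for t
    by (simp flip: circulant_norm_concatenation
        add: concatenation_inverse_coords circulant_norm_scaleR circulant_norm_Id)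
  then show ?thesis
    using assms unfolding family_coords_iff_circulant_norm
    by (metis mult_zero_right power_eq_0_iff)
qed

lemma triangle_family_concatenation_inverse:
  assumes "\<Delta> \<in> triangles" "\<Psi> \<in> family_coords"
  shows "triangle_family \<Delta> (\<Psi> \<star> inverse_coords \<Psi>) = triangle_family \<Delta> \<Phi>_Id"
proof -
  have "triangle_family \<Delta> \<Phi>_Id = triangle_family \<Delta> (\<Psi> \<star> inverse_coords \<Psi>)"
    using assms
    by (subst triangle_family_eq_iff[OF assms(1) Id_family_coords
          concatenation_family_coords[OF assms(2) inverse_coords_family_coords[OF assms(2)]]])
      (auto simp: concatenation_inverse_coords family_coords_iff_circulant_norm)
  then show ?thesis ..
qed

text \<open>Bilinearity makes the concatenation well defined on families: rescaling the two factors by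
  \<open>k\<close> and \<open>l\<close> rescales the product by \<open>k l\<close>.\<close>

lemma triangle_family_concatenation_cong:
  assumes \<Delta>: "\<Delta> \<in> triangles"
    and mem: "\<Psi> \<in> family_coords" "\<Psi>' \<in> family_coords" "\<Xi> \<in> family_coords" "\<Xi>' \<in> family_coords"
    and eq: "triangle_family \<Delta> \<Psi> = triangle_family \<Delta> \<Xi>" "triangle_family \<Delta> \<Psi>' = triangle_family \<Delta> \<Xi>'"
  shows "triangle_family \<Delta> (\<Psi> \<star> \<Psi>') = triangle_family \<Delta> (\<Xi> \<star> \<Xi>')"
proof -
  obtain k where k: "\<And>t. k t \<noteq> 0" "\<Xi> = (\<lambda>t. k t *\<^sub>R \<Psi> t)"
    using eq(1) triangle_family_eq_iff[OF \<Delta> mem(1,3)] by auto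
  obtain l where l: "\<And>t. l t \<noteq> 0" "\<Xi>' = (\<lambda>t. l t *\<^sub>R \<Psi>' t)"
    using eq(2) triangle_family_eq_iff[OF \<Delta> mem(2,4)] by auto
  have "k t * l t \<noteq> 0 \<and> (\<Xi> \<star> \<Xi>') t = (k t * l t) *\<^sub>R (\<Psi> \<star> \<Psi>') t" for t
    using k(1) l(1) by (simp add: k(2) l(2) concatenation_scaleR)
  then show ?thesis
    unfolding triangle_family_eq_iff[OF \<Delta> concatenation_family_coords[OF mem(1,2)]
        concatenation_family_coords[OF mem(3,4)]]
    by (intro exI[of _ "\<lambda>t. k t * l t"]) blast
qed

lemma family_group_mult:
  assumes "\<Delta> \<in> triangles" "\<Psi> \<in> family_coords" "\<Psi>' \<in> family_coords"
  shows "triangle_family \<Delta> \<Psi> \<otimes>\<^bsub>family_group \<Delta>\<^esub> triangle_family \<Delta> \<Psi>'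
    = triangle_family \<Delta> (\<Psi> \<star> \<Psi>')"
  unfolding family_group_def monoid.simps
proof (rule the_equality)
  fix H
  assume "\<exists>\<Xi>\<in>family_coords. \<exists>\<Xi>'\<in>family_coords. triangle_family \<Delta> \<Psi> = triangle_family \<Delta> \<Xi>
    \<and> triangle_family \<Delta> \<Psi>' = triangle_family \<Delta> \<Xi>' \<and> H = triangle_family \<Delta> (\<Xi> \<star> \<Xi>')"
  then show "H = triangle_family \<Delta> (\<Psi> \<star> \<Psi>')"
    using triangle_family_concatenation_cong[OF assms] by metis
qed (use assms in blast)

lemma family_group_carrier: "carrier (family_group \<Delta>) = triangle_family \<Delta> ` family_coords"
  by (simp add: family_group_def)

lemma family_group_one: "\<one>\<^bsub>family_group \<Delta>\<^esub> = triangle_family \<Delta> \<Phi>_Id"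
  by (simp add: family_group_def)

lemma family_group_inverse_mult:
  assumes "\<Delta> \<in> triangles" "\<Psi> \<in> family_coords"
  shows "triangle_family \<Delta> (inverse_coords \<Psi>) \<otimes>\<^bsub>family_group \<Delta>\<^esub> triangle_family \<Delta> \<Psi>
    = \<one>\<^bsub>family_group \<Delta>\<^esub>"
  using assms
  by (simp add: family_group_mult inverse_coords_family_coords family_group_one
      concatenation_commute[of "inverse_coords \<Psi>"] triangle_family_concatenation_inverse)

lemma comm_group_family_group:
  assumes \<Delta>: "\<Delta> \<in> triangles"
  shows "comm_group (family_group \<Delta>)"
proof (rule comm_groupI)
  note simps = family_group_carrier family_group_mult[OF \<Delta>] concatenation_family_coords
  fix F G H
  assume F: "F \<in> carrier (family_group \<Delta>)" and G: "G \<in> carrier (family_group \<Delta>)"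
  show "F \<otimes>\<^bsub>family_group \<Delta>\<^esub> G \<in> carrier (family_group \<Delta>)"
    using F G by (auto simp: simps)
  show "F \<otimes>\<^bsub>family_group \<Delta>\<^esub> G = G \<otimes>\<^bsub>family_group \<Delta>\<^esub> F"
    using F G by (auto simp: simps concatenation_commute)
  show "F \<otimes>\<^bsub>family_group \<Delta>\<^esub> G \<otimes>\<^bsub>family_group \<Delta>\<^esub> H
      = F \<otimes>\<^bsub>family_group \<Delta>\<^esub> (G \<otimes>\<^bsub>family_group \<Delta>\<^esub> H)"
    if "H \<in> carrier (family_group \<Delta>)"
    using F G that by (auto simp: simps concatenation_assoc)
  show "\<one>\<^bsub>family_group \<Delta>\<^esub> \<otimes>\<^bsub>family_group \<Delta>\<^esub> F = F"
    using F by (auto simp: simps family_group_one Id_family_coords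
        concatenation_commute[of \<Phi>_Id] concatenation_Id)
  show "\<exists>G\<in>carrier (family_group \<Delta>). G \<otimes>\<^bsub>family_group \<Delta>\<^esub> F = \<one>\<^bsub>family_group \<Delta>\<^esub>"
    using F family_group_inverse_mult[OF \<Delta>] inverse_coords_family_coords
    by (auto simp: family_group_carrier)
qed (simp add: family_group_carrier family_group_one Id_family_coords)

lemma family_group_inv:
  assumes "\<Delta> \<in> triangles" "\<Psi> \<in> family_coords"
  shows "inv\<^bsub>family_group \<Delta>\<^esub> (triangle_family \<Delta> \<Psi>) = triangle_family \<Delta> (inverse_coords \<Psi>)"
proof -
  interpret comm_group "family_group \<Delta>"
    using assms(1) by (rule comm_group_family_group)
  show ?thesis
    using assms family_group_inverse_mult
    by (intro inv_equality) (auto simp: family_group_carrier inverse_coords_family_coords)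
qed

theorem lemma8:
  fixes \<Delta> :: triangle
  assumes "\<Delta> \<in> triangles"
  shows
   "(\<forall>\<Psi>\<in>family_coords. \<forall>\<Psi>'\<in>family_coords. \<Psi> \<star> \<Psi>' = \<Psi>' \<star> \<Psi>)
    \<and> (\<forall>\<Psi>\<in>family_coords. \<forall>\<Psi>'\<in>family_coords. \<forall>\<Psi>''\<in>family_coords.
         \<Psi> \<star> (\<Psi>' \<star> \<Psi>'') = (\<Psi> \<star> \<Psi>') \<star> \<Psi>'')
    \<and> (\<Phi>_Id \<in> family_coords \<and> (\<forall>\<Psi>\<in>family_coords. \<Psi> \<star> \<Phi>_Id = \<Psi>))
    \<and> (\<forall>\<Psi>\<in>family_coords. inverse_coords \<Psi> \<in> family_coords
         \<and> triangle_family \<Delta> (\<Psi> \<star> inverse_coords \<Psi>) = triangle_family \<Delta> \<Phi>_Id)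
    \<and> (\<forall>\<Psi>\<in>family_coords. \<forall>\<Psi>'\<in>family_coords. \<Psi> \<star> \<Psi>' \<in> family_coords
         \<and> triangle_family \<Delta> \<Psi> \<otimes>\<^bsub>family_group \<Delta>\<^esub> triangle_family \<Delta> \<Psi>'
             = triangle_family \<Delta> (\<Psi> \<star> \<Psi>'))
    \<and> comm_group (family_group \<Delta>)
    \<and> \<one>\<^bsub>family_group \<Delta>\<^esub> = triangle_family \<Delta> \<Phi>_Id
    \<and> (\<forall>\<Psi>\<in>family_coords.
         inv\<^bsub>family_group \<Delta>\<^esub> (triangle_family \<Delta> \<Psi>) = triangle_family \<Delta> (inverse_coords \<Psi>))"
  using assms
  by (intro conjI ballI concatenation_commute concatenation_assoc Id_family_coords
      concatenation_Id inverse_coords_family_coords triangle_family_concatenation_inverse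
      concatenation_family_coords family_group_mult comm_group_family_group family_group_one
      family_group_inv)

end
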